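(* Let $n\ge 1$, let $\Omega\subset\mathbb{R}^n$ be a bounded connected open set, and let $F\in C^0(\Omega\times\mathbb{R}\times\mathbb{R}^n\times\mathcal{S}^{n\times n})$ satisfy $$F(x,s,p,M+N)\ge F(x,s,p,M)\quad\text{for all }(x,s,p,M)\in\Omega\times\mathbb{R}\times\mathbb{R}^n\times\mathcal{S}^{n\times n}\text{ and all }N\in\mathcal{S}^{n\times n}_+.$$ Let $E\subset\Omega$ be a smooth closed submanifold of dimension $k$, $0\le k\le n-1$, and let $f\in USC(\Omega)$. Assume that $u\in LSC(\Omega)$ is lowerconical on $E$ and satisfies $$F(x,u,\nabla u,\nabla^2u)\le f(x)\quad\text{in }\Omega\setminus E\text{ in the viscosity sense}.$$ Then $$F(x,u,\nabla u,\nabla^2u)\le f(x)\quad\text{in }\Omega\text{ in the viscosity sense}.$$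
   Context: $\mathcal{S}^{n\times n}$ is the set of real symmetric $n\times n$ matrices and $\mathcal{S}^{n\times n}_+$ its subset of positive definite matrices. $LSC(\Omega)$, $USC(\Omega)$ are the sets of (real-valued) lower-/upper-semicontinuous functions on $\Omega$. A closed submanifold is compact and without boundary (for $k=0$: finitely many points). Lowerconical on a set: a function $u\in LSC(\Omega)$ with $\inf_\Omega u>-\infty$ is lowerconical on $E\subset\Omega$ if for every $\eta\in C^\infty(\Omega)$, every $\bar x\in E$ and every $\epsilon>0$, $$\inf_{x\in\Omega}\Big((u+\eta)(x)-(u+\eta)(\bar x)-\epsilon\,\mathrm{dist}(x,E)\Big)<0,$$ where $\mathrm{dist}(x,E)$ is the distance from $x$ to $E$. Viscosity sense: for an open set $U$ and $u\in LSC(U)$, "$F(x,u,\nabla u,\nabla^2u)\le f(x)$ in $U$ in the viscosity sense" means: whenever $x_0\in U$ and $\varphi$ is a $C^2$ function near $x_0$ with $\varphi\le u$ near $x_0$ and $\varphi(x_0)=u(x_0)$, one has $F(x_0,\varphi(x_0),\nabla\varphi(x_0),\nabla^2\varphi(x_0))\le f(x_0)$. *)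

theory Defs
  imports "HOL-Analysis.Analysis"
begin

section \<open>Regularity of functions\<close>

text \<open>For open \<open>S\<close>, \<open>C_on k S f\<close> says that \<open>f\<close> is of class \<open>C^k\<close> on \<open>S\<close>: all iterated
  directional derivatives of order at most \<open>k\<close> exist and are continuous. Recursing on the
  directional derivatives instead of the derivative map keeps the codomain type fixed.\<close>

primrec C_on ::
  "nat \<Rightarrow> 'a::real_normed_vector set \<Rightarrow> ('a \<Rightarrow> 'b::real_normed_vector) \<Rightarrow> bool" where
  "C_on 0 S f \<longleftrightarrow> continuous_on S f"
| "C_on (Suc k) S f \<longleftrightarrow>
     (\<forall>x\<in>S. f differentiable (at x)) \<and>
     (\<forall>v. C_on k S (\<lambda>x. frechet_derivative f (at x) v))"

definition smooth_on :: "'a::real_normed_vector set \<Rightarrow> ('a \<Rightarrow> 'b::real_normed_vector) \<Rightarrow> bool" where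
  "smooth_on S f \<longleftrightarrow> (\<forall>k. C_on k S f)"

definition LSC :: "'a::topological_space set \<Rightarrow> ('a \<Rightarrow> real) set" where
  "LSC S = {u. \<forall>x\<in>S. \<forall>a < u x. \<forall>\<^sub>F y in at x within S. a < u y}"

definition USC :: "'a::topological_space set \<Rightarrow> ('a \<Rightarrow> real) set" where
  "USC S = {u. \<forall>x\<in>S. \<forall>a > u x. \<forall>\<^sub>F y in at x within S. u y < a}"

definition grad :: "(real^'n \<Rightarrow> real) \<Rightarrow> real^'n \<Rightarrow> real^'n" where
  "grad f x = (\<chi> i. frechet_derivative f (at x) (axis i 1))"

definition hessian :: "(real^'n \<Rightarrow> real) \<Rightarrow> real^'n \<Rightarrow> real^'n^'n" where
  "hessian f x = jacobian (grad f) (at x)"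

section \<open>Matrices\<close>

definition sym_matrices :: "(real^'n^'n) set" where
  "sym_matrices = {M. transpose M = M}"

definition posdef_matrices :: "(real^'n^'n) set" where
  "posdef_matrices = {N \<in> sym_matrices. \<forall>v. v \<noteq> 0 \<longrightarrow> v \<bullet> (N *v v) > 0}"

section \<open>Closed submanifolds\<close>

text \<open>Embedded submanifolds without boundary, described by charts of the ambient space that
  straighten \<open>E\<close> locally to a \<open>k\<close>-dimensional linear subspace. Neither connectedness nor
  nonemptiness is required; for \<open>k = 0\<close> these are exactly the finite sets.\<close>

definition smooth_closed_submanifold :: "nat \<Rightarrow> 'a::euclidean_space set \<Rightarrow> bool" where
  "smooth_closed_submanifold k E \<longleftrightarrow>
     compact E \<and>
     (\<forall>p\<in>E. \<exists>U V L. \<exists>\<phi> \<psi> :: 'a \<Rightarrow> 'a.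
        open U \<and> p \<in> U \<and> open V \<and>
        homeomorphism U V \<phi> \<psi> \<and> smooth_on U \<phi> \<and> smooth_on V \<psi> \<and>
        subspace L \<and> dim L = k \<and> \<phi> ` (E \<inter> U) = L \<inter> V)"

section \<open>Lowerconical functions and viscosity supersolutions\<close>

text \<open>The infima are taken in the extended reals, since \<open>\<eta>\<close> may be unbounded on \<open>\<Omega>\<close>.\<close>

definition lowerconical_on ::
  "'a::euclidean_space set \<Rightarrow> 'a set \<Rightarrow> ('a \<Rightarrow> real) \<Rightarrow> bool" where
  "lowerconical_on \<Omega> E u \<longleftrightarrow>
     u \<in> LSC \<Omega> \<and> (INF x\<in>\<Omega>. ereal (u x)) > -\<infinity> \<and>
     (\<forall>\<eta>. smooth_on \<Omega> \<eta> \<longrightarrow> (\<forall>xbar\<in>E. \<forall>\<epsilon>>0.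
        (INF x\<in>\<Omega>. ereal ((u x + \<eta> x) - (u xbar + \<eta> xbar) - \<epsilon> * infdist x E)) < 0))"

text \<open>\<open>F(x, u, \<nabla>u, \<nabla>\<^sup>2u) \<le> f(x)\<close> in the open set \<open>U\<close>. Test functions are total
  functions of which only the germ at \<open>x0\<close> matters.\<close>

definition viscosity_le ::
  "(real^'n \<Rightarrow> real \<Rightarrow> real^'n \<Rightarrow> real^'n^'n \<Rightarrow> real) \<Rightarrow> (real^'n \<Rightarrow> real) \<Rightarrow>
   (real^'n) set \<Rightarrow> (real^'n \<Rightarrow> real) \<Rightarrow> bool" where
  "viscosity_le F f U u \<longleftrightarrow>
     (\<forall>x0\<in>U. \<forall>\<phi>.
        (\<exists>W. open W \<and> x0 \<in> W \<and> C_on 2 W \<phi>) \<and>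
        (\<forall>\<^sub>F x in nhds x0. \<phi> x \<le> u x) \<and> \<phi> x0 = u x0 \<longrightarrow>
        F x0 (\<phi> x0) (grad \<phi> x0) (hessian \<phi> x0) \<le> f x0)"

end

theory Submission
  imports Defs
begin

text \<open>
  Let \<open>\<phi>\<close> touch \<open>u\<close> from below at a point \<open>z\<close> of \<open>E\<close>; at other points of \<open>\<Omega>\<close> the hypothesis applies
  directly. The idea is to move the touching point off \<open>E\<close> by adding a small multiple of the distance
  to \<open>E\<close>, and to let this multiple tend to \<open>0\<close>.

  The function \<open>\<phi>\<close> is first replaced by a polynomial \<open>Q\<close> that has the same value and gradient at \<open>z\<close>, a
  Hessian smaller by \<open>\<delta>\<close> times the identity, and satisfies \<open>u - Q \<ge> c |x - z|\<^sup>2\<close> on all of \<open>\<Omega>\<close>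
  (\<open>strict_quartic_minorant\<close>). As \<open>u\<close> is lowerconical, \<open>u - Q - \<epsilon> dist(x, E)\<close> takes negative values
  for every \<open>\<epsilon> > 0\<close>, and by the quadratic gap it does so only near \<open>z\<close>, where \<open>E\<close> is straightened
  to a linear subspace \<open>L\<close> by a chart \<open>\<Phi>\<close>. There \<open>dist(x, E)\<close> is at most a constant times
  \<open>dist(\<Phi> x, L)\<close>, so \<open>u - Q - t dist(\<Phi> x, L)\<close> is negative somewhere as well, for each small \<open>t > 0\<close>.
  It is nonnegative on \<open>E\<close>, hence attains its minimum at a point \<open>x\<close> outside \<open>E\<close>.

  The distance to \<open>L\<close> is the maximum of \<open>y \<mapsto> e \<bullet> y\<close> over unit normals \<open>e\<close> (and \<open>0\<close>). Taking the \<open>e\<close> that is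
  exact at \<open>\<Phi> x\<close>, the function \<open>Q + t (e \<bullet> \<Phi>) + const\<close> is of class \<open>C\<^sup>2\<close> and touches \<open>u\<close> from below
  at \<open>x\<close> (\<open>touching_near_submanifold\<close>). The differential inequality holds there. The vectors \<open>e\<close> are
  bounded and \<open>\<Phi>\<close> is a fixed chart, so as \<open>t\<close> tends to \<open>0\<close> these 2-jets converge to the 2-jet of \<open>Q\<close> at
  \<open>z\<close> (\<open>vanishing_perturbation\<close>), and the inequality survives in the limit
  (\<open>viscosity_inequality_at_strict_minorant\<close>). Finally \<open>\<delta>\<close> tends to \<open>0\<close>.
\<close>

section \<open>Calculus of functions of class \<open>C\<^sup>k\<close>\<close>

lemma C_on_cong:
  assumes "open S" and "C_on k S f" and "\<And>x. x \<in> S \<Longrightarrow> f x = g x"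
  shows "C_on k S g"
  using assms(2,3)
proof (induction k arbitrary: f g)
  case 0
  then show ?case by (auto cong: continuous_on_cong)
next
  case (Suc k)
  have der: "(g has_derivative frechet_derivative f (at x)) (at x)" if "x \<in> S" for x
    using has_derivative_transform_within_open[OF _ assms(1) that, of f _ UNIV g] Suc.prems that
    by (auto simp: frechet_derivative_works)
  then have "frechet_derivative f (at x) v = frechet_derivative g (at x) v" if "x \<in> S" for x v
    using frechet_derivative_at[OF der] that by metis
  then have "C_on k S (\<lambda>x. frechet_derivative g (at x) v)" for v
    using Suc.IH Suc.prems(1) by (metis (no_types, lifting) C_on.simps(2))
  then show ?case
    using der by (auto simp: differentiable_def)
qed

text \<open>Differentiability only has to be checked against a candidate derivative: the predicate
  \<open>C_on\<close> speaks of \<open>frechet_derivative\<close>, which is awkward to compute with, while an explicit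
  \<open>f'\<close> comes out of the usual differentiation rules.\<close>

lemma C_on_SucI:
  assumes "open S" and der: "\<And>x. x \<in> S \<Longrightarrow> (f has_derivative f' x) (at x)"
    and f': "\<And>v. C_on k S (\<lambda>x. f' x v)"
  shows "C_on (Suc k) S f"
proof -
  have "f' x v = frechet_derivative f (at x) v" if "x \<in> S" for x v
    using frechet_derivative_at[OF der] that by metis
  then have "C_on k S (\<lambda>x. frechet_derivative f (at x) v)" for v
    by (rule C_on_cong[OF assms(1) f'])
  then show ?thesis
    using der by (auto simp: differentiable_def)
qed

lemma C_on_mono_order: "C_on (Suc k) S f \<Longrightarrow> C_on k S f"
proof (induction k arbitrary: f)
  case 0
  then show ?case
    by (auto intro: continuous_at_imp_continuous_on differentiable_imp_continuous_within)
next
  case (Suc k)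
  then show ?case by (metis C_on.simps(2))
qed

lemma C_on_continuous: "C_on k S f \<Longrightarrow> continuous_on S f"
proof (induction k)
  case (Suc k)
  show ?case by (rule Suc.IH[OF C_on_mono_order[OF Suc.prems]])
qed simp

lemma C_on_subset: "C_on k T f \<Longrightarrow> S \<subseteq> T \<Longrightarrow> C_on k S f"
  by (induction k arbitrary: f) (auto intro: continuous_on_subset)

lemma C_on_const: "open S \<Longrightarrow> C_on k S (\<lambda>x. c)"
  by (induction k arbitrary: c) (auto simp: frechet_derivative_const)

lemma C_on_bounded_linear_comp:
  assumes "open S" and "bounded_linear h" and "C_on k S f"
  shows "C_on k S (\<lambda>x. h (f x))"
  using assms(3)
proof (induction k arbitrary: f)
  case 0
  then show ?case
    using bounded_linear.continuous_on[OF assms(2)] by auto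
next
  case (Suc k)
  have "((\<lambda>x. h (f x)) has_derivative (\<lambda>v. h (frechet_derivative f (at x) v))) (at x)"
    if "x \<in> S" for x
    using Suc.prems that
    by (intro bounded_linear.has_derivative[OF assms(2)]) (auto simp: frechet_derivative_works)
  then show ?case
    by (rule C_on_SucI[OF assms(1)]) (use Suc in auto)
qed

lemma C_on_add:
  assumes "open S" and "C_on k S f" and "C_on k S g"
  shows "C_on k S (\<lambda>x. f x + g x)"
  using assms(2,3)
proof (induction k arbitrary: f g)
  case 0
  then show ?case by (auto intro: continuous_intros)
next
  case (Suc k)
  have "((\<lambda>x. f x + g x) has_derivative
      (\<lambda>v. frechet_derivative f (at x) v + frechet_derivative g (at x) v)) (at x)"
    if "x \<in> S" for x
    using Suc.prems that by (intro has_derivative_add) (auto simp: frechet_derivative_works)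
  then show ?case
    by (rule C_on_SucI[OF assms(1)]) (use Suc in auto)
qed

text \<open>Every iterated directional derivative of a product is again a sum of such products, so one
  induction covers scalar multiplication, inner products and multiplication of reals.\<close>

lemma C_on_bounded_bilinear:
  assumes "open S" and "bounded_bilinear B" and "C_on k S f" and "C_on k S g"
  shows "C_on k S (\<lambda>x. B (f x) (g x))"
  using assms(3,4)
proof (induction k arbitrary: f g)
  case 0
  then show ?case using bounded_bilinear.continuous_on[OF assms(2)] by auto
next
  case (Suc k)
  have "((\<lambda>x. B (f x) (g x)) has_derivative
      (\<lambda>v. B (f x) (frechet_derivative g (at x) v) + B (frechet_derivative f (at x) v) (g x)))
      (at x)" if "x \<in> S" for x
    using Suc.prems that
    by (intro bounded_bilinear.FDERIV[OF assms(2)]) (auto simp: frechet_derivative_works)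
  moreover have "C_on k S f" "C_on k S g"
    using Suc.prems C_on_mono_order by blast+
  ultimately show ?case
    by (intro C_on_SucI[OF assms(1)])
      (use Suc assms(1) in \<open>auto intro!: C_on_add\<close>)
qed

lemma C_on_id: "open S \<Longrightarrow> C_on k S (\<lambda>x. x)"
proof (cases k)
  case (Suc j)
  assume "open S"
  then show ?thesis
    unfolding Suc by (intro C_on_SucI[where f' = "\<lambda>x v. v"] C_on_const) auto
qed auto

lemma smooth_on_uminus:
  assumes "smooth_on UNIV Q" and "open S"
  shows "smooth_on S (\<lambda>x. - Q x)"
  unfolding smooth_on_def
proof
  fix k
  have "C_on k UNIV Q" using assms(1) unfolding smooth_on_def ..
  then have "C_on k S Q" by (rule C_on_subset) (rule subset_UNIV)
  then show "C_on k S (\<lambda>x. - Q x)"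
    by (rule C_on_bounded_linear_comp[OF assms(2) bounded_linear_minus[OF bounded_linear_ident]])
qed

section \<open>Gradients and Hessians\<close>

lemma grad_eqI:
  assumes "(f has_derivative (\<lambda>v. a \<bullet> v)) (at x)"
  shows "grad f x = a"
  unfolding grad_def frechet_derivative_at[OF assms, symmetric]
  by (simp add: inner_axis vec_eq_iff)

lemma has_derivative_grad:
  fixes f :: "real^'n \<Rightarrow> real"
  assumes "f differentiable (at x)"
  shows "(f has_derivative (\<lambda>v. grad f x \<bullet> v)) (at x)"
proof -
  let ?D = "frechet_derivative f (at x)"
  have D: "(f has_derivative ?D) (at x)"
    using assms by (simp add: frechet_derivative_works)
  have "?D v = grad f x \<bullet> v" for v
  proof -
    have "?D v = ?D (\<Sum>i\<in>UNIV. v $ i *s axis i 1)"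
      by (simp add: basis_expansion)
    also have "\<dots> = (\<Sum>i\<in>UNIV. v $ i * ?D (axis i 1))"
      using has_derivative_linear[OF D]
      by (simp add: linear_sum linear_cmul scalar_mult_eq_scaleR)
    also have "\<dots> = grad f x \<bullet> v"
      by (simp add: grad_def inner_vec_def mult.commute)
    finally show ?thesis .
  qed
  then have "?D = (\<lambda>v. grad f x \<bullet> v)" by auto
  then show ?thesis using D by simp
qed

lemma hessian_eqI:
  assumes "(grad f has_derivative (\<lambda>v. A *v v)) (at x)"
  shows "hessian f x = A"
  unfolding hessian_def jacobian_def frechet_derivative_at[OF assms, symmetric] by simp

lemma frechet_derivative_axis: "frechet_derivative f (at x) (axis i 1) = grad f x $ i"
  by (simp add: grad_def)

lemma C2_grad:
  fixes f :: "real^'n \<Rightarrow> real"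
  assumes "C_on 2 W f" and "x \<in> W"
  shows C2_has_derivative_grad: "(f has_derivative (\<lambda>v. grad f x \<bullet> v)) (at x)"
    and C2_grad_has_derivative_hessian: "(grad f has_derivative (\<lambda>v. hessian f x *v v)) (at x)"
proof -
  show "(f has_derivative (\<lambda>v. grad f x \<bullet> v)) (at x)"
    using assms by (auto simp: numeral_2_eq_2 intro: has_derivative_grad)
  have "(\<lambda>y. grad f y $ i) differentiable (at x)" for i
    using assms by (simp add: numeral_2_eq_2 flip: frechet_derivative_axis)
  then have "(\<lambda>y. grad f y \<bullet> b) differentiable (at x)" if "b \<in> Basis" for b
    using that by (auto simp: Basis_vec_def inner_axis)
  then have "grad f differentiable (at x)"
    by (subst differentiable_componentwise_within) auto
  then show "(grad f has_derivative (\<lambda>v. hessian f x *v v)) (at x)"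
    unfolding hessian_def jacobian_works .
qed

lemma hessian_component:
  fixes f :: "real^'n \<Rightarrow> real"
  assumes "C_on 2 W f" and "x \<in> W"
  shows "hessian f x $ i $ j
    = frechet_derivative (\<lambda>y. frechet_derivative f (at y) (axis i 1)) (at x) (axis j 1)"
proof -
  have D: "((\<lambda>y. grad f y $ i) has_derivative (\<lambda>v. (hessian f x *v v) $ i)) (at x)"
    by (intro bounded_linear.has_derivative[OF bounded_linear_vec_nth] C2_grad_has_derivative_hessian[OF assms])
  then show ?thesis
    unfolding frechet_derivative_axis[of f] frechet_derivative_at[OF D, symmetric]
    by (simp add: matrix_vector_mult_basis column_def)
qed

lemma C2_continuous_grad:
  fixes f :: "real^'n \<Rightarrow> real"
  assumes "C_on 2 W f"
  shows "continuous_on W (grad f)"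
  using C2_grad_has_derivative_hessian[OF assms]
  by (meson continuous_at_imp_continuous_on has_derivative_continuous)

lemma C2_continuous_hessian:
  fixes f :: "real^'n \<Rightarrow> real"
  assumes "C_on 2 W f"
  shows "continuous_on W (hessian f)"
proof -
  have "continuous_on W (\<lambda>x. hessian f x $ i $ j)" for i j
    using assms by (subst continuous_on_cong[OF refl hessian_component[OF assms]])
      (auto simp: numeral_2_eq_2)
  then have "continuous_on W (\<lambda>x. \<chi> i j. hessian f x $ i $ j)"
    by (intro continuous_on_vec_lambda)
  then show ?thesis by simp
qed

lemma C2_add_scaled:
  fixes f g :: "real^'n \<Rightarrow> real"
  assumes W: "open W" "x \<in> W" and f: "C_on 2 W f" and g: "C_on 2 W g"
  shows C_on_add_scaled: "C_on 2 W (\<lambda>y. f y + t * g y + b)"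
    and grad_add_scaled: "grad (\<lambda>y. f y + t * g y + b) x = grad f x + t *\<^sub>R grad g x"
    and hessian_add_scaled: "hessian (\<lambda>y. f y + t * g y + b) x = hessian f x + t *\<^sub>R hessian g x"
proof -
  let ?h = "\<lambda>y. f y + t * g y + b"
  show "C_on 2 W ?h"
    by (intro C_on_add C_on_const W f C_on_bounded_linear_comp[OF W(1) bounded_linear_mult_right g])
  have grad: "grad ?h y = grad f y + t *\<^sub>R grad g y" if "y \<in> W" for y
  proof (rule grad_eqI)
    show "(?h has_derivative (\<lambda>v. (grad f y + t *\<^sub>R grad g y) \<bullet> v)) (at y)"
      by (rule has_derivative_eq_rhs[OF has_derivative_add[OF has_derivative_add[OF
              C2_has_derivative_grad[OF f that]
              has_derivative_mult_right[OF C2_has_derivative_grad[OF g that]]]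
            has_derivative_const]])
        (simp add: inner_add_left)
  qed
  then show "grad ?h x = grad f x + t *\<^sub>R grad g x" using W(2) .
  show "hessian ?h x = hessian f x + t *\<^sub>R hessian g x"
  proof (rule hessian_eqI)
    have "((\<lambda>y. grad f y + t *\<^sub>R grad g y) has_derivative
        (\<lambda>v. (hessian f x + t *\<^sub>R hessian g x) *v v)) (at x)"
      by (rule has_derivative_eq_rhs[OF has_derivative_add[OF
              C2_grad_has_derivative_hessian[OF f W(2)]
              has_derivative_scaleR_right[OF C2_grad_has_derivative_hessian[OF g W(2)]]]])
        (simp add: matrix_vector_mult_add_rdistrib scaleR_matrix_vector_assoc)
    then show "(grad ?h has_derivative (\<lambda>v. (hessian f x + t *\<^sub>R hessian g x) *v v)) (at x)"
      by (rule has_derivative_transform_within_open[OF _ W]) (simp add: grad)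
  qed
qed

text \<open>Mean value theorem for \<open>t \<mapsto> f (x + s v + t w) - f (x + t w) - t (w \<bullet> A (s v))\<close> on
  \<open>[0, s]\<close>. The linear parts of \<open>G\<close> at \<open>x\<close> cancel in its derivative and only two remainders of
  size \<open>e * s * (norm v + norm w)\<close> are left. Differentiability of \<open>G\<close> at the single point \<open>x\<close>
  therefore determines \<open>w \<bullet> (A *v v)\<close> as the limit of second difference quotients.\<close>

lemma second_difference_bound:
  fixes f :: "real^'n \<Rightarrow> real"
  assumes f: "\<And>y. y \<in> ball x d \<Longrightarrow> (f has_derivative (\<lambda>v. G y \<bullet> v)) (at y)"
    and G: "\<And>y. y \<in> ball x d \<Longrightarrow> norm (G y - G x - A *v (y - x)) \<le> e * norm (y - x)"
    and s: "0 < s" "s * (norm v + norm w) < d" and "0 \<le> e"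
  shows "\<bar>f (x + s *\<^sub>R v + s *\<^sub>R w) - f (x + s *\<^sub>R v) - f (x + s *\<^sub>R w) + f x - s^2 * (w \<bullet> (A *v v))\<bar>
    \<le> 2 * e * s^2 * (norm v + norm w)^2"
proof -
  define N where "N = norm v + norm w"
  define k where "k t = f (x + s *\<^sub>R v + t *\<^sub>R w) - f (x + t *\<^sub>R w) - t * (w \<bullet> (A *v (s *\<^sub>R v)))" for t
  define k' where "k' t = (G (x + s *\<^sub>R v + t *\<^sub>R w) - G (x + t *\<^sub>R w)) \<bullet> w
    - w \<bullet> (A *v (s *\<^sub>R v))" for t
  have near: "norm (s *\<^sub>R v + t *\<^sub>R w) \<le> s * N" "norm (t *\<^sub>R w) \<le> s * N" if "t \<in> {0..s}" for t
  proof -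
    have "norm (t *\<^sub>R w) \<le> s * norm w"
      using that by (auto intro: mult_right_mono)
    moreover have "norm (s *\<^sub>R v) = s * norm v" "0 \<le> s * norm v" using s by auto
    ultimately show "norm (s *\<^sub>R v + t *\<^sub>R w) \<le> s * N" "norm (t *\<^sub>R w) \<le> s * N"
      using norm_triangle_ineq[of "s *\<^sub>R v" "t *\<^sub>R w"] by (auto simp: N_def algebra_simps)
  qed
  have inball: "x + s *\<^sub>R v + t *\<^sub>R w \<in> ball x d" "x + t *\<^sub>R w \<in> ball x d" if "t \<in> {0..s}" for t
    using near[OF that] s(2) dist_add_cancel[of x 0 "s *\<^sub>R v + t *\<^sub>R w"] dist_add_cancel[of x 0 "t *\<^sub>R w"]
    by (simp_all add: N_def add.assoc)
  have der: "(k has_derivative (\<lambda>r. r * k' t)) (at t within {0..s})" if t: "t \<in> {0..s}" for t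
  proof -
    have 1: "((\<lambda>t. f (x + s *\<^sub>R v + t *\<^sub>R w)) has_derivative (\<lambda>r. G (x + s *\<^sub>R v + t *\<^sub>R w) \<bullet> (r *\<^sub>R w)))
        (at t within {0..s})"
      by (rule has_derivative_compose[where f = "\<lambda>t. x + s *\<^sub>R v + t *\<^sub>R w", OF _ f[OF inball(1)[OF t]]]) (auto intro!: derivative_eq_intros)
    have 2: "((\<lambda>t. f (x + t *\<^sub>R w)) has_derivative (\<lambda>r. G (x + t *\<^sub>R w) \<bullet> (r *\<^sub>R w))) (at t within {0..s})"
      by (rule has_derivative_compose[where f = "\<lambda>t. x + t *\<^sub>R w", OF _ f[OF inball(2)[OF t]]]) (auto intro!: derivative_eq_intros)
    show ?thesis
      unfolding k_def
      by (rule has_derivative_eq_rhs[OF has_derivative_diff[OF has_derivative_diff[OF 1 2]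
            has_derivative_mult_left[OF has_derivative_ident]]])
        (auto simp: k'_def algebra_simps)
  qed
  have bound: "\<bar>k' t\<bar> \<le> 2 * e * s * N^2" if t: "t \<in> {0..s}" for t
  proof -
    define a where "a = G (x + s *\<^sub>R v + t *\<^sub>R w) - G x - A *v (s *\<^sub>R v + t *\<^sub>R w)"
    define b where "b = G (x + t *\<^sub>R w) - G x - A *v (t *\<^sub>R w)"
    have "norm a \<le> e * norm (s *\<^sub>R v + t *\<^sub>R w)" "norm b \<le> e * norm (t *\<^sub>R w)"
      using G[OF inball(1)[OF t]] G[OF inball(2)[OF t]] by (simp_all add: a_def b_def add.assoc)
    then have ab: "norm a \<le> e * (s * N)" "norm b \<le> e * (s * N)"
      using near[OF t] \<open>0 \<le> e\<close> by (meson mult_left_mono order_trans)+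
    have "k' t = (a - b) \<bullet> w"
      by (simp add: k'_def a_def b_def matrix_vector_right_distrib algebra_simps inner_commute)
    then have "\<bar>k' t\<bar> \<le> norm (a - b) * norm w"
      using Cauchy_Schwarz_ineq2 by metis
    also have "\<dots> \<le> (2 * e * s * N) * N"
      using ab norm_triangle_ineq4[of a b] s \<open>0 \<le> e\<close> by (intro mult_mono) (auto simp: N_def)
    finally show ?thesis by (simp add: power2_eq_square mult.assoc)
  qed
  have "norm (k s - k 0) \<le> (2 * e * s * N^2) * norm (s - 0)"
  proof (rule differentiable_bound[of "{0..s}" k "\<lambda>t r. r * k' t"])
    show "onorm (\<lambda>r. r * k' t) \<le> 2 * e * s * N^2" if "t \<in> {0..s}" for t
    proof (rule onorm_le)
      show "norm (r * k' t) \<le> (2 * e * s * N^2) * norm r" for r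
        using mult_right_mono[OF bound[OF that], of "\<bar>r\<bar>"] by (simp add: abs_mult mult_ac)
    qed
  qed (use der s in auto)
  moreover have "k s - k 0 = f (x + s *\<^sub>R v + s *\<^sub>R w) - f (x + s *\<^sub>R v) - f (x + s *\<^sub>R w) + f x
      - s^2 * (w \<bullet> (A *v v))"
    by (simp add: k_def power2_eq_square matrix_vector_mult_scaleR algebra_simps)
  ultimately show ?thesis
    using s by (simp add: N_def power2_eq_square algebra_simps)
qed

lemma has_derivative_remainder_bound:
  assumes "(G has_derivative D) (at x)" and "0 < e"
  obtains d where "0 < d" "\<And>y. y \<in> ball x d \<Longrightarrow> norm (G y - G x - D (y - x)) \<le> e * norm (y - x)"
  using assms unfolding has_derivative_at_alt
  by (metis dist_commute dist_norm mem_ball)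

text \<open>The second difference of \<open>f\<close> along \<open>v\<close> and \<open>w\<close> does not change when the two directions are
  exchanged, while by \<open>second_difference_bound\<close> with \<open>A\<close> the Hessian, its two leading terms are \<open>w \<bullet> (A *v v)\<close> and
  \<open>v \<bullet> (A *v w)\<close>. Symmetry is what places the Hessians of test functions in the domain on which
  \<open>F\<close> is continuous.\<close>

lemma hessian_symmetric:
  fixes f :: "real^'n \<Rightarrow> real"
  assumes "open W" and "C_on 2 W f" and "x \<in> W"
  shows "hessian f x \<in> sym_matrices"
proof -
  define A where "A = hessian f x"
  have sym: "w \<bullet> (A *v v) = v \<bullet> (A *v w)" for v w
  proof (rule ccontr)
    assume "w \<bullet> (A *v v) \<noteq> v \<bullet> (A *v w)"
    define g where "g = \<bar>w \<bullet> (A *v v) - v \<bullet> (A *v w)\<bar>"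
    define N where "N = norm v + norm w + 1"
    have "0 < g" "1 \<le> N" using \<open>_ \<noteq> _\<close> by (auto simp: g_def N_def)
    \<comment> \<open>an asymmetry \<open>g\<close> is at most \<open>4 * e * N^2\<close>, so any factor above \<open>4\<close> gives a contradiction; the
      summand \<open>1\<close> in \<open>N\<close> only avoids division by zero\<close>
    define e where "e = g / (5 * N^2)"
    have "0 < e" using \<open>0 < g\<close> \<open>1 \<le> N\<close> by (simp add: e_def)
    obtain d1 where d1: "0 < d1" "\<And>y. y \<in> ball x d1 \<Longrightarrow>
        norm (grad f y - grad f x - A *v (y - x)) \<le> e * norm (y - x)"
      using has_derivative_remainder_bound[OF C2_grad_has_derivative_hessian[OF assms(2,3)] \<open>0 < e\<close>]
      unfolding A_def by blast
    obtain d2 where d2: "0 < d2" "ball x d2 \<subseteq> W"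
      using assms by (meson openE)
    define d where "d = min d1 d2"
    define s where "s = d / (2 * N)"
    have "0 < d" using d1 d2 by (simp add: d_def)
    then have s: "0 < s" "s * (norm v + norm w) < d"
      using \<open>1 \<le> N\<close> by (auto simp: s_def N_def field_simps add_strict_increasing)
    have f: "(f has_derivative (\<lambda>v. grad f y \<bullet> v)) (at y)" if "y \<in> ball x d" for y
      using C2_has_derivative_grad[OF assms(2)] that d2 by (auto simp: d_def)
    have G: "norm (grad f y - grad f x - A *v (y - x)) \<le> e * norm (y - x)" if "y \<in> ball x d" for y
      using d1 that by (auto simp: d_def)
    note 1 = second_difference_bound[OF f G s less_imp_le[OF \<open>0 < e\<close>]]
    have s': "s * (norm w + norm v) < d" using s by (simp add: add.commute)
    note 2 = second_difference_bound[OF f G s(1) s' less_imp_le[OF \<open>0 < e\<close>]]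
    have swap: "x + s *\<^sub>R w + s *\<^sub>R v = x + s *\<^sub>R v + s *\<^sub>R w" by simp
    have "\<bar>s^2 * (w \<bullet> (A *v v)) - s^2 * (v \<bullet> (A *v w))\<bar> \<le> 4 * e * s^2 * (norm v + norm w)^2"
      using 1 2 unfolding swap by (simp add: add.commute[of "norm w"])
    also have "\<dots> \<le> 4 * e * s^2 * N^2"
      using \<open>0 < e\<close> by (intro mult_left_mono power_mono) (auto simp: N_def)
    finally have "s^2 * g \<le> s^2 * (4 * e * N^2)"
      by (simp add: g_def abs_mult flip: right_diff_distrib) (simp add: mult_ac)
    then have "g \<le> 4 * e * N^2" using s(1) by simp
    then show False using \<open>0 < g\<close> \<open>1 \<le> N\<close> by (simp add: e_def)
  qed
  have "A $ i $ j = A $ j $ i" for i j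
    using sym[of "axis i 1" "axis j 1"]
    by (simp add: matrix_vector_mult_basis column_def inner_axis')
  then show ?thesis
    by (simp add: sym_matrices_def A_def transpose_def vec_eq_iff)
qed

section \<open>Strict quartic minorants\<close>

lemma sym_matrices_inner:
  assumes "H \<in> sym_matrices"
  shows "v \<bullet> (H *v w) = (H *v v) \<bullet> w"
  using assms dot_lmul_matrix[of v H w] unfolding sym_matrices_def
  by (metis (mono_tags, lifting) mem_Collect_eq transpose_matrix_vector)

lemma mat_sym: "mat c \<in> sym_matrices"
  by (simp add: sym_matrices_def transpose_mat)

lemma mat_mult_vector: "mat c *v v = c *\<^sub>R (v :: real^'n)"
  by (simp add: mat_def matrix_vector_mult_def vec_eq_iff if_distrib[of "\<lambda>x. x * _"] cong: if_cong)

text \<open>For symmetric \<open>H\<close>, the polynomial with 2-jet \<open>(a, p, H)\<close> at \<open>z\<close>. The quartic term leaves the 2-jet alone and, for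
  large \<open>K\<close>, forces the polynomial below any function that is bounded below on a bounded set, away
  from \<open>z\<close>.\<close>

definition quartic :: "real \<Rightarrow> real^'n \<Rightarrow> real^'n^'n \<Rightarrow> real \<Rightarrow> real^'n \<Rightarrow> real^'n \<Rightarrow> real" where
  "quartic a p H K z x = a + p \<bullet> (x - z) + (x - z) \<bullet> (H *v (x - z)) / 2 - K * (norm (x - z))^4"

lemma norm_power4: "norm x ^ 4 = (x \<bullet> x) * (x \<bullet> x)"
  by (simp add: dot_square_norm power2_eq_square power4_eq_xxxx)

lemma C_on_quartic: "C_on k UNIV (quartic a p H K z)"
proof -
  have 1: "C_on k UNIV (\<lambda>x. x - z)"
    using C_on_add[OF open_UNIV C_on_id[OF open_UNIV] C_on_const[OF open_UNIV], of k "- z"] by simp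
  have 2: "C_on k UNIV (\<lambda>x. H *v (x - z))"
    by (intro C_on_bounded_linear_comp[OF _ _ 1]) auto
  have 3: "C_on k UNIV (\<lambda>x. p \<bullet> (x - z))"
    by (intro C_on_bounded_linear_comp[OF _ _ 1]) (auto intro: bounded_linear_inner_right)
  have 4: "C_on k UNIV (\<lambda>x. (x - z) \<bullet> (H *v (x - z)))"
    by (intro C_on_bounded_bilinear[OF _ bounded_bilinear_inner 1 2]) auto
  have 5: "C_on k UNIV (\<lambda>x. (x - z) \<bullet> (x - z))"
    by (intro C_on_bounded_bilinear[OF _ bounded_bilinear_inner 1 1]) auto
  have 6: "C_on k UNIV (\<lambda>x. ((x - z) \<bullet> (x - z)) * ((x - z) \<bullet> (x - z)))"
    by (intro C_on_bounded_bilinear[OF _ bounded_bilinear_mult 5 5]) auto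
  have "C_on k UNIV (\<lambda>x. a + p \<bullet> (x - z) + (x - z) \<bullet> (H *v (x - z)) * (1/2)
      + (- K) * (((x - z) \<bullet> (x - z)) * ((x - z) \<bullet> (x - z))))"
    by (intro C_on_add C_on_const 3 C_on_bounded_linear_comp[OF _ bounded_linear_mult_left 4]
        C_on_bounded_linear_comp[OF _ bounded_linear_mult_right 6] open_UNIV)
  then show ?thesis
    unfolding quartic_def[abs_def] norm_power4 by simp
qed

lemma smooth_on_quartic: "smooth_on UNIV (quartic a p H K z)"
  by (simp add: smooth_on_def C_on_quartic)

lemma quartic_center: "quartic a p H K z z = a"
  by (simp add: quartic_def)

lemma quartic_has_derivative:
  assumes "H \<in> sym_matrices"
  shows "(quartic a p H K z has_derivative
    (\<lambda>v. (p + H *v (x - z) - (4 * K * ((x - z) \<bullet> (x - z))) *\<^sub>R (x - z)) \<bullet> v)) (at x)"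
proof -
  have h: "((\<lambda>x. x - z) has_derivative (\<lambda>v. v)) (at x)"
    by (auto intro!: derivative_eq_intros)
  have Hh: "((\<lambda>x. H *v (x - z)) has_derivative (\<lambda>v. H *v v)) (at x)"
    by (rule bounded_linear.has_derivative[OF matrix_vector_mul_bounded_linear h])
  note hh = has_derivative_inner[OF h h]
  have eq: "0 + p \<bullet> v + (h \<bullet> (H *v v) + v \<bullet> (H *v h)) * inverse 2
      - K * (h \<bullet> h * (h \<bullet> v + v \<bullet> h) + (h \<bullet> v + v \<bullet> h) * (h \<bullet> h))
    = (p + H *v h - (4 * K * (h \<bullet> h)) *\<^sub>R h) \<bullet> v" for h v
    unfolding inner_commute[of v] sym_matrices_inner[OF assms, of h v]
    by (simp add: inner_add_left inner_diff_left)
  show ?thesis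
    unfolding quartic_def[abs_def] norm_power4 divide_inverse
    by (rule has_derivative_eq_rhs[OF has_derivative_diff[OF has_derivative_add[OF
          has_derivative_add[OF has_derivative_const has_derivative_inner_right[OF h]]
          has_derivative_mult_left[OF has_derivative_inner[OF h Hh]]]
          has_derivative_mult_right[OF has_derivative_mult[OF hh hh]]]])
      (rule ext, rule eq)
qed

lemma grad_quartic:
  assumes "H \<in> sym_matrices"
  shows "grad (quartic a p H K z) x = p + H *v (x - z) - (4 * K * ((x - z) \<bullet> (x - z))) *\<^sub>R (x - z)"
  by (rule grad_eqI[OF quartic_has_derivative[OF assms]])

lemma hessian_quartic:
  assumes "H \<in> sym_matrices"
  shows "hessian (quartic a p H K z) z = H"
proof (rule hessian_eqI)
  have h: "((\<lambda>x. x - z) has_derivative (\<lambda>v. v)) (at z)"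
    by (auto intro!: derivative_eq_intros)
  have Hh: "((\<lambda>x. H *v (x - z)) has_derivative (\<lambda>v. H *v v)) (at z)"
    by (rule bounded_linear.has_derivative[OF matrix_vector_mul_bounded_linear h])
  show "(grad (quartic a p H K z) has_derivative (\<lambda>v. H *v v)) (at z)"
    unfolding grad_quartic[OF assms, abs_def]
    by (rule has_derivative_eq_rhs[OF has_derivative_diff[OF
          has_derivative_add[OF has_derivative_const Hh]
          has_derivative_scaleR[OF has_derivative_mult_right[OF has_derivative_inner[OF h h]] h]]])
      auto
qed

text \<open>Taylor's formula with Peano remainder. The derivative of the difference is
  \<open>o(norm (y - z))\<close> because \<open>grad \<phi>\<close> is differentiable at \<open>z\<close>, and the mean value theorem on the
  ball of radius \<open>norm (x - z)\<close> gains one more power.\<close>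

lemma taylor2:
  fixes \<phi> :: "real^'n \<Rightarrow> real"
  assumes W: "open W" "C_on 2 W \<phi>" "z \<in> W" and "0 < e"
  obtains r where "0 < r"
    "\<And>x. x \<in> ball z r \<Longrightarrow> \<bar>\<phi> x - quartic (\<phi> z) (grad \<phi> z) (hessian \<phi> z) 0 z x\<bar> \<le> e * norm (x - z)^2"
proof -
  define T where "T = quartic (\<phi> z) (grad \<phi> z) (hessian \<phi> z) 0 z"
  note sym = hessian_symmetric[OF W]
  obtain r1 where r1: "0 < r1" "\<And>y. y \<in> ball z r1 \<Longrightarrow>
      norm (grad \<phi> y - grad \<phi> z - hessian \<phi> z *v (y - z)) \<le> e * norm (y - z)"
    using has_derivative_remainder_bound[OF C2_grad_has_derivative_hessian[OF W(2,3)] \<open>0 < e\<close>]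
    by blast
  obtain r2 where r2: "0 < r2" "ball z r2 \<subseteq> W"
    using W by (meson openE)
  have "\<bar>\<phi> x - T x\<bar> \<le> e * norm (x - z)^2" if x: "x \<in> ball z (min r1 r2)" for x
  proof -
    define D where "D y v = (grad \<phi> y - grad T y) \<bullet> v" for y v
    have der: "((\<lambda>y. \<phi> y - T y) has_derivative D y) (at y)" if "y \<in> ball z (min r1 r2)" for y
    proof -
      have "(\<phi> has_derivative (\<lambda>v. grad \<phi> y \<bullet> v)) (at y)"
        using C2_has_derivative_grad[OF W(2)] that r2 by auto
      moreover have "(T has_derivative (\<lambda>v. grad T y \<bullet> v)) (at y)"
        unfolding T_def grad_quartic[OF sym] by (rule quartic_has_derivative[OF sym])
      ultimately show ?thesis
        unfolding D_def inner_diff_left by (rule has_derivative_diff)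
    qed
    have "norm ((\<phi> x - T x) - (\<phi> z - T z)) \<le> (e * norm (x - z)) * norm (x - z)"
    proof (rule differentiable_bound[of "cball z (norm (x - z))" "\<lambda>y. \<phi> y - T y" D])
      fix y assume y: "y \<in> cball z (norm (x - z))"
      then have yb: "y \<in> ball z (min r1 r2)"
        using x by (auto simp: dist_norm norm_minus_commute)
      show "((\<lambda>y. \<phi> y - T y) has_derivative D y) (at y within cball z (norm (x - z)))"
        using der[OF yb] by (rule has_derivative_at_withinI)
      have "norm (grad \<phi> y - grad T y) \<le> e * norm (y - z)"
        using r1(2)[of y] yb by (simp add: T_def grad_quartic[OF sym] algebra_simps)
      also have "\<dots> \<le> e * norm (x - z)"
        using y \<open>0 < e\<close> by (simp add: dist_norm norm_minus_commute)
      finally have le: "norm (grad \<phi> y - grad T y) \<le> e * norm (x - z)" .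
      show "onorm (D y) \<le> e * norm (x - z)"
      proof (rule onorm_le)
        show "norm (D y v) \<le> e * norm (x - z) * norm v" for v
          using mult_right_mono[OF le, of "norm v"] Cauchy_Schwarz_ineq2[of "grad \<phi> y - grad T y" v]
          by (simp add: D_def)
      qed
    qed (auto simp: dist_norm norm_minus_commute)
    moreover have "T z = \<phi> z" by (simp add: T_def quartic_def)
    ultimately show ?thesis by (simp add: power2_eq_square mult.assoc)
  qed
  then show ?thesis
    using that[of "min r1 r2"] r1 r2 unfolding T_def by auto
qed

text \<open>Lowering the Hessian of a test function by \<open>\<delta>\<close> times the identity turns local touching into a quadratic gap
  near \<open>z\<close>. Far from \<open>z\<close> the quartic term takes over. The gain over the test function itself is that the
  minorant is smooth and lies below \<open>u\<close> on all of \<open>\<Omega>\<close>, as the lowerconical condition demands.\<close>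

lemma strict_quartic_minorant:
  fixes \<phi> u :: "real^'n \<Rightarrow> real"
  assumes W: "open W" "C_on 2 W \<phi>" "z \<in> W"
    and "bounded \<Omega>" and m: "\<And>x. x \<in> \<Omega> \<Longrightarrow> m \<le> u x"
    and ev: "\<forall>\<^sub>F x in nhds z. \<phi> x \<le> u x" and "\<phi> z = u z" and "0 < \<delta>"
  obtains K where "\<And>x. x \<in> \<Omega> \<Longrightarrow>
    quartic (u z) (grad \<phi> z) (hessian \<phi> z - mat \<delta>) K z x + \<delta> / 4 * norm (x - z)^2 \<le> u x"
proof -
  define T where "T = quartic (\<phi> z) (grad \<phi> z) (hessian \<phi> z) 0 z"
  have Q: "quartic (u z) (grad \<phi> z) (hessian \<phi> z - mat \<delta>) K z x
      = T x - \<delta> / 2 * norm (x - z)^2 - K * norm (x - z)^4" for K x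
  proof -
    have "h \<bullet> ((hessian \<phi> z - mat \<delta>) *v h) = h \<bullet> (hessian \<phi> z *v h) - \<delta> * norm h^2" for h
      by (simp only: matrix_vector_mult_diff_rdistrib mat_mult_vector inner_diff_right
          inner_scaleR_right dot_square_norm)
    then show ?thesis
      using \<open>\<phi> z = u z\<close> by (simp add: quartic_def T_def diff_divide_distrib)
  qed
  obtain r1 where r1: "0 < r1" "\<And>x. x \<in> ball z r1 \<Longrightarrow> \<bar>\<phi> x - T x\<bar> \<le> \<delta> / 4 * norm (x - z)^2"
    using taylor2[OF W, of "\<delta> / 4"] \<open>0 < \<delta>\<close> unfolding T_def by auto
  obtain r2 where r2: "0 < r2" "\<And>x. x \<in> ball z r2 \<Longrightarrow> \<phi> x \<le> u x"
    using ev unfolding eventually_nhds_metric by (auto simp: dist_commute)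
  define r where "r = min r1 r2"
  have "0 < r" using r1 r2 by (simp add: r_def)
  have "continuous_on UNIV T"
    using C_on_quartic[of 0] by (simp add: T_def)
  then have "bounded (T ` closure \<Omega>)"
    using \<open>bounded \<Omega>\<close> by (meson compact_closure compact_continuous_image compact_imp_bounded
        continuous_on_subset subset_UNIV)
  then obtain B where B: "\<And>x. x \<in> \<Omega> \<Longrightarrow> \<bar>T x\<bar> \<le> B"
    unfolding bounded_iff using closure_subset by fastforce
  define K where "K = max 0 ((B - m) / r^4)"
  have "T x - \<delta> / 2 * norm (x - z)^2 - K * norm (x - z)^4 + \<delta> / 4 * norm (x - z)^2 \<le> u x"
    if x: "x \<in> \<Omega>" for x
  proof (cases "x \<in> ball z r")
    case True
    then have "\<bar>\<phi> x - T x\<bar> \<le> \<delta> / 4 * norm (x - z)^2" "\<phi> x \<le> u x"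
      using r1(2)[of x] r2(2)[of x] by (auto simp: r_def)
    then have "T x - \<delta> / 4 * norm (x - z)^2 \<le> u x" by linarith
    moreover have "0 \<le> K * norm (x - z)^4" by (simp add: K_def)
    ultimately show ?thesis by linarith
  next
    case False
    then have "r^4 \<le> norm (x - z)^4"
      using \<open>0 < r\<close> by (intro power_mono) (auto simp: dist_norm norm_minus_commute)
    then have "K * r^4 \<le> K * norm (x - z)^4"
      by (intro mult_left_mono) (auto simp: K_def)
    moreover have "B - m \<le> K * r^4"
      using \<open>0 < r\<close> by (simp add: K_def flip: pos_divide_le_eq)
    moreover have "0 \<le> \<delta> / 4 * norm (x - z)^2" using \<open>0 < \<delta>\<close> by simp
    ultimately show ?thesis using B[OF x] m[OF x] by linarith
  qed
  then show ?thesis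
    using that[of K] unfolding Q by auto
qed

section \<open>Straightening a submanifold\<close>

lemma C1_locally_lipschitz:
  fixes f :: "'a::euclidean_space \<Rightarrow> 'b::real_normed_vector"
  assumes "open V" and "C_on 1 V f" and "p \<in> V"
  obtains r C where "0 < r" "0 < C" "ball p r \<subseteq> V"
    "\<And>x y. x \<in> ball p r \<Longrightarrow> y \<in> ball p r \<Longrightarrow> norm (f x - f y) \<le> C * norm (x - y)"
proof -
  have diff: "f differentiable (at y)" if "y \<in> V" for y
    using assms(2) that unfolding One_nat_def C_on.simps by blast
  obtain r where r: "0 < r" "cball p r \<subseteq> V"
    using assms(1,3) open_contains_cball by blast
  have "\<exists>B. \<forall>y\<in>cball p r. norm (frechet_derivative f (at y) b) \<le> B" for b
  proof -
    have "continuous_on (cball p r) (\<lambda>y. frechet_derivative f (at y) b)"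
      using assms(2) unfolding One_nat_def C_on.simps by (blast intro: continuous_on_subset[OF _ r(2)])
    then have "bounded ((\<lambda>y. frechet_derivative f (at y) b) ` cball p r)"
      by (intro compact_imp_bounded compact_continuous_image compact_cball)
    then show ?thesis unfolding bounded_iff by blast
  qed
  then have "\<exists>B. \<forall>b. \<forall>y\<in>cball p r. norm (frechet_derivative f (at y) b) \<le> B b"
    by (intro choice) blast
  then obtain B where B: "\<And>b y. y \<in> cball p r \<Longrightarrow> norm (frechet_derivative f (at y) b) \<le> B b"
    by blast
  define C where "C = (\<Sum>b\<in>Basis. B b)"
  have on: "onorm (frechet_derivative f (at y)) \<le> \<bar>C\<bar> + 1" if y: "y \<in> ball p r" for y
  proof (rule onorm_le)
    fix v
    let ?D = "frechet_derivative f (at y)"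
    have "y \<in> V" using r(2) y by auto
    then have lin: "linear ?D" by (intro linear_frechet_derivative diff)
    have "norm (?D v) = norm (?D (\<Sum>b\<in>Basis. (v \<bullet> b) *\<^sub>R b))"
      by (simp add: euclidean_representation)
    also have "\<dots> = norm (\<Sum>b\<in>Basis. (v \<bullet> b) *\<^sub>R ?D b)"
      by (simp add: linear_sum[OF lin] linear_cmul[OF lin])
    also have "\<dots> \<le> (\<Sum>b\<in>Basis. norm v * B b)"
    proof (rule sum_norm_le)
      fix b :: 'a assume "b \<in> Basis"
      then have "\<bar>v \<bullet> b\<bar> \<le> norm v" by (rule Basis_le_norm)
      moreover have "norm (?D b) \<le> B b" using B y by simp
      ultimately show "norm ((v \<bullet> b) *\<^sub>R ?D b) \<le> norm v * B b"
        unfolding norm_scaleR by (rule mult_mono) auto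
    qed
    also have "\<dots> = C * norm v" by (simp add: C_def sum_distrib_left mult.commute)
    also have "\<dots> \<le> (\<bar>C\<bar> + 1) * norm v" by (intro mult_right_mono) auto
    finally show "norm (?D v) \<le> (\<bar>C\<bar> + 1) * norm v" .
  qed
  have "norm (f x - f y) \<le> (\<bar>C\<bar> + 1) * norm (x - y)" if "x \<in> ball p r" "y \<in> ball p r" for x y
  proof (rule differentiable_bound[OF convex_ball _ on that])
    fix w assume "w \<in> ball p r"
    then have "w \<in> V" using r(2) by auto
    then have "f differentiable (at w)" by (rule diff)
    then show "(f has_derivative frechet_derivative f (at w)) (at w within ball p r)"
      using frechet_derivative_works has_derivative_at_withinI by blast
  qed
  moreover have "ball p r \<subseteq> V" using r(2) ball_subset_cball by blast
  moreover have "0 < \<bar>C\<bar> + 1" by simp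
  ultimately show ?thesis using that r(1) by blast
qed

text \<open>A chart \<open>\<Phi>\<close> that straightens \<open>E\<close> turns the distance to \<open>E\<close>, which is hard to differentiate, into
  the distance to a linear subspace. The comparison holds since the inverse chart is
  locally Lipschitz: it carries the point of \<open>L\<close> nearest to \<open>\<Phi> x\<close> to a point of \<open>E\<close> near \<open>x\<close>.\<close>

lemma submanifold_flattening:
  fixes E :: "'a::euclidean_space set"
  assumes "smooth_closed_submanifold k E" and "p \<in> E"
  obtains U L and \<Phi> :: "'a \<Rightarrow> 'a" and r C where "open U" "0 < r" "0 < C" "cball p r \<subseteq> U" "C_on 2 U \<Phi>"
    "subspace L" "\<And>x. x \<in> E \<inter> U \<Longrightarrow> \<Phi> x \<in> L"
    "\<And>x. x \<in> cball p r \<Longrightarrow> infdist x E \<le> C * infdist (\<Phi> x) L"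
proof -
  obtain U V L and \<phi> \<psi> :: "'a \<Rightarrow> 'a" where U: "open U" "p \<in> U" and V: "open V"
    and hom: "homeomorphism U V \<phi> \<psi>" and sm: "smooth_on U \<phi>" "smooth_on V \<psi>"
    and L: "subspace L" "\<phi> ` (E \<inter> U) = L \<inter> V"
    using assms unfolding smooth_closed_submanifold_def by metis
  have pL: "\<phi> p \<in> L \<inter> V" using L(2) U(2) assms(2) by blast
  obtain \<rho> C where \<rho>: "0 < \<rho>" "0 < C" "ball (\<phi> p) \<rho> \<subseteq> V"
    and lip: "\<And>x y. x \<in> ball (\<phi> p) \<rho> \<Longrightarrow> y \<in> ball (\<phi> p) \<rho> \<Longrightarrow> norm (\<psi> x - \<psi> y) \<le> C * norm (x - y)"
    using C1_locally_lipschitz[OF V, of \<psi> "\<phi> p"] sm(2) pL unfolding smooth_on_def by auto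
  have "continuous_on U \<phi>" using hom by (simp add: homeomorphism_def)
  then have "isCont \<phi> p" using U continuous_on_eq_continuous_at by blast
  then obtain d where d: "0 < d" "\<And>x. dist x p < d \<Longrightarrow> dist (\<phi> x) (\<phi> p) < \<rho> / 2"
    unfolding continuous_at_eps_delta using \<rho>(1) by (metis half_gt_zero)
  obtain r0 where r0: "0 < r0" "cball p r0 \<subseteq> U"
    using U open_contains_cball by blast
  define r where "r = min r0 (d / 2)"
  have r: "0 < r" "cball p r \<subseteq> U" using r0 d(1) by (auto simp: r_def)
  have "infdist x E \<le> C * infdist (\<phi> x) L" if x: "x \<in> cball p r" for x
  proof -
    define y where "y = \<phi> x"
    have y: "dist y (\<phi> p) < \<rho> / 2"
      using d(1) x unfolding y_def r_def by (intro d(2)) (simp add: dist_commute)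
    obtain a where a: "a \<in> L" "infdist y L = dist y a"
      using infdist_attains_inf[of L y] closed_subspace[OF L(1)] pL by auto
    \<comment> \<open>the nearest point of \<open>L\<close> may fall outside \<open>V\<close>; staying within \<open>\<rho> / 2\<close> of \<open>\<phi> p \<in> L\<close>
    keeps it within \<open>\<rho>\<close>\<close>
    have "dist y a \<le> dist y (\<phi> p)"
      using infdist_le[of "\<phi> p" L y] pL a(2) by simp
    then have "dist a (\<phi> p) < \<rho>"
      using y dist_triangle[of a "\<phi> p" y] by (simp add: dist_commute)
    then have ab: "a \<in> ball (\<phi> p) \<rho>" "y \<in> ball (\<phi> p) \<rho>"
      using y \<rho>(1) by (auto simp: dist_commute)
    then have "a \<in> \<phi> ` (E \<inter> U)" using a(1) \<rho>(3) L(2) by blast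
    then have "\<psi> a \<in> E" using hom by (auto simp: homeomorphism_def)
    then have "infdist x E \<le> dist x (\<psi> a)" by (rule infdist_le)
    also have "\<psi> y = x" using hom x r(2) by (auto simp: homeomorphism_def y_def)
    then have "dist x (\<psi> a) \<le> C * dist y a"
      using lip[OF ab(2,1)] by (simp add: dist_norm)
    finally show ?thesis using a(2) by (simp add: y_def)
  qed
  then show ?thesis
    using that[of U r C \<phi> L] U(1) r \<rho>(2) sm(1) L unfolding smooth_on_def by blast
qed

text \<open>The distance to a subspace is the largest of its linear minorants \<open>z \<mapsto> e \<bullet> z\<close> with \<open>e\<close>
  normal to \<open>L\<close> and of norm at most \<open>1\<close>. The one that is exact at \<open>y\<close> points from the projection of \<open>y\<close>
  to \<open>y\<close>, and is \<open>0\<close> if \<open>y\<close> lies in \<open>L\<close>.\<close>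

lemma subspace_norming_normal:
  fixes L :: "'a::euclidean_space set"
  assumes "subspace L"
  obtains e where "norm e \<le> 1" "e \<bullet> y = infdist y L" "\<And>z. e \<bullet> z \<le> infdist z L"
proof -
  have "0 \<in> L" "closed L" "convex L"
    using assms by (auto intro: subspace_0 closed_subspace subspace_imp_convex)
  then obtain a where a: "a \<in> L" "infdist y L = dist y a"
    using infdist_attains_inf[of L y] by auto
  define e where "e = sgn (y - a)"
  have "(y - a) \<bullet> b = 0" if b: "b \<in> L" for b
  proof -
    have min: "\<forall>z\<in>L. dist y a \<le> dist y z" using a(2) infdist_le by metis
    have "(y - a) \<bullet> ((a + c) - a) \<le> 0" if "c \<in> L" for c
      by (rule any_closest_point_dot[OF \<open>convex L\<close> \<open>closed L\<close> a(1) _ min])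
        (use a(1) that assms in \<open>auto intro: subspace_add\<close>)
    from this[of b] this[of "- b"] show ?thesis
      using b assms subspace_neg by fastforce
  qed
  then have orth: "e \<bullet> b = 0" if "b \<in> L" for b
    using that by (simp add: e_def sgn_div_norm)
  have ne: "norm e \<le> 1" by (simp add: e_def norm_sgn)
  have "e \<bullet> y = e \<bullet> (y - a)" using orth[OF a(1)] by (simp add: inner_diff_right)
  also have "\<dots> = dist y a"
    by (cases "y = a") (auto simp: e_def sgn_div_norm dist_norm dot_square_norm power2_eq_square)
  finally have "e \<bullet> y = infdist y L" using a(2) by simp
  moreover have "e \<bullet> z \<le> infdist z L" for z
  proof -
    obtain b where b: "b \<in> L" "infdist z L = dist z b"
      using infdist_attains_inf[of L z] \<open>0 \<in> L\<close> \<open>closed L\<close> by auto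
    have "e \<bullet> z = e \<bullet> (z - b)" using orth[OF b(1)] by (simp add: inner_diff_right)
    also have "\<dots> \<le> norm e * norm (z - b)" by (rule norm_cauchy_schwarz)
    also have "\<dots> \<le> norm (z - b)" using ne mult_right_mono[of "norm e" 1 "norm (z - b)"] by simp
    finally show ?thesis using b(2) by (simp add: dist_norm)
  qed
  ultimately show ?thesis using that ne by blast
qed

section \<open>Semicontinuous functions\<close>

text \<open>If no point were minimal, each \<open>x\<close> would have a better competitor \<open>b x\<close> that stays better on a
  neighbourhood of \<open>x\<close>. Finitely many neighbourhoods cover \<open>K\<close>, and the best of their finitely
  many competitors lies in one of them, where some other competitor is better still.\<close>

lemma LSC_attains_min:
  assumes "compact K" and "K \<noteq> {}" and "w \<in> LSC K"
  obtains x where "x \<in> K" "\<And>y. y \<in> K \<Longrightarrow> w x \<le> w y"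
proof -
  have "\<exists>x\<in>K. \<forall>y\<in>K. w x \<le> w y"
  proof (rule ccontr)
    assume "\<not> ?thesis"
    then have "\<forall>x\<in>K. \<exists>y\<in>K. w y < w x" by (meson not_le)
    then obtain b where b: "\<And>x. x \<in> K \<Longrightarrow> b x \<in> K \<and> w (b x) < w x" by metis
    have "\<exists>T. open T \<and> x \<in> T \<and> (\<forall>y\<in>T \<inter> K. w (b x) < w y)" if x: "x \<in> K" for x
    proof -
      have "\<forall>\<^sub>F y in at x within K. w (b x) < w y"
        using assms(3) b[OF x] x unfolding LSC_def by blast
      then show ?thesis
        using b[OF x] unfolding eventually_at_topological by (metis IntD1 IntD2)
    qed
    then obtain T where T: "\<And>x. x \<in> K \<Longrightarrow> open (T x) \<and> x \<in> T x \<and> (\<forall>y\<in>T x \<inter> K. w (b x) < w y)"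
      by metis
    have "K \<subseteq> (\<Union>x\<in>K. T x)" using T by blast
    then obtain K' where K': "K' \<subseteq> K" "finite K'" "K \<subseteq> (\<Union>x\<in>K'. T x)"
      using compactE_image[OF assms(1), of K T] T by metis
    then have "K' \<noteq> {}" using assms(2) by auto
    then obtain x where x: "x \<in> K'" "\<And>y. y \<in> K' \<Longrightarrow> w (b x) \<le> w (b y)"
      using ex_is_arg_min_if_finite[OF K'(2), of "\<lambda>x. w (b x)"] unfolding is_arg_min_linorder by blast
    obtain y where y: "y \<in> K'" "b x \<in> T y" using K' b x by blast
    then have "w (b y) < w (b x)" using T b x K'(1) by blast
    then show False using x(2)[OF y(1)] by simp
  qed
  then show ?thesis using that by blast
qed

lemma LSC_diff_continuous:
  assumes "u \<in> LSC S" and "K \<subseteq> S" and "continuous_on K h"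
  shows "(\<lambda>x. u x - h x) \<in> LSC K"
  unfolding LSC_def
proof (intro CollectI ballI allI impI)
  fix x a assume x: "x \<in> K" and a: "a < u x - h x"
  define \<eta> where "\<eta> = (u x - h x - a) / 2"
  have "0 < \<eta>" using a by (simp add: \<eta>_def)
  have "\<forall>\<^sub>F y in at x within S. u x - \<eta> < u y"
    using assms(1,2) x \<open>0 < \<eta>\<close> unfolding LSC_def by auto
  then have "\<forall>\<^sub>F y in at x within K. u x - \<eta> < u y"
    by (rule filter_leD[OF at_le[OF assms(2)]])
  moreover have "\<forall>\<^sub>F y in at x within K. h y < h x + \<eta>"
    using assms(3) x \<open>0 < \<eta>\<close> by (auto simp: continuous_on_def intro: order_tendstoD)
  ultimately show "\<forall>\<^sub>F y in at x within K. a < u y - h y"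
    by eventually_elim (simp add: \<eta>_def field_simps)
qed

lemma USC_limit_le:
  assumes "f \<in> USC \<Omega>" and "z \<in> \<Omega>" and "\<And>m. x m \<in> \<Omega> - {z}" and "x \<longlonglongrightarrow> z"
    and "y \<longlonglongrightarrow> l" and "\<And>m. y m \<le> f (x m)"
  shows "l \<le> f z"
proof (rule dense_ge)
  fix a assume "f z < a"
  then have "\<forall>\<^sub>F w in at z within \<Omega>. f w < a"
    using assms(1,2) unfolding USC_def by blast
  moreover have "filterlim x (at z within \<Omega>) sequentially"
    using assms(3,4) unfolding filterlim_at by auto
  ultimately have "\<forall>\<^sub>F m in sequentially. f (x m) < a"
    unfolding filterlim_iff by blast
  then have "\<forall>\<^sub>F m in sequentially. y m \<le> a"
    by eventually_elim (metis assms(6) less_imp_le order_trans)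
  then show "l \<le> a"
    by (rule tendsto_upperbound[OF assms(5)]) simp
qed

section \<open>Touching outside the submanifold\<close>

text \<open>A point of \<open>E\<close> where \<open>u\<close> is touched strictly from below by a smooth
  \<open>Q\<close> is approximated by points outside \<open>E\<close> where \<open>u\<close> is touched by \<open>Q\<close> plus a
  small \<open>C\<^sup>2\<close> perturbation. With \<open>g x = infdist (\<Phi> x) L\<close>, which dominates a
  multiple of the distance to \<open>E\<close>, the lowerconical condition makes \<open>u - Q - t g\<close> negative
  somewhere, and the quadratic gap confines this to a small ball around \<open>z\<close>. On \<open>E\<close> the
  function \<open>u - Q - t g\<close> equals \<open>u - Q \<ge> 0\<close>, so its minimum point is outside \<open>E\<close>. There
  the function \<open>g\<close> can be replaced by its minorant \<open>y \<mapsto> e \<bullet> \<Phi> y\<close>, which is exact at that point.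
  The chart \<open>\<Phi>\<close> is fixed and only the unit-bounded vector \<open>e\<close> varies, so the derivatives of the
  perturbation tend to \<open>0\<close> with \<open>t\<close>.\<close>

lemma touching_near_submanifold:
  fixes u Q :: "'a::euclidean_space \<Rightarrow> real"
  assumes "open \<Omega>" and "E \<subseteq> \<Omega>" and E: "smooth_closed_submanifold k E" and "z \<in> E"
    and lc: "lowerconical_on \<Omega> E u"
    and Q: "smooth_on UNIV Q" "Q z = u z" and "0 < c"
    and gap: "\<And>x. x \<in> \<Omega> \<Longrightarrow> Q x + c * norm (x - z)^2 \<le> u x"
  obtains \<Phi> :: "'a \<Rightarrow> 'a" and r where "0 < r" "ball z r \<subseteq> \<Omega>" "C_on 2 (ball z r) \<Phi>"
    "\<And>\<tau>. 0 < \<tau> \<Longrightarrow> \<exists>x t e b. x \<in> ball z r - E \<and> dist x z < \<tau> \<and> 0 < t \<and> t < \<tau> \<and> norm e \<le> 1 \<and>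
       \<bar>u x - Q x\<bar> < \<tau> \<and> (\<forall>y\<in>ball z r. Q y + t * (e \<bullet> \<Phi> y) + b \<le> u y) \<and>
       Q x + t * (e \<bullet> \<Phi> x) + b = u x"
proof -
  obtain U L and \<Phi> :: "'a \<Rightarrow> 'a" and r0 C where U: "open U" "0 < r0" "0 < C" "cball z r0 \<subseteq> U" "C_on 2 U \<Phi>"
    and L: "subspace L" "\<And>x. x \<in> E \<inter> U \<Longrightarrow> \<Phi> x \<in> L"
    and cmp: "\<And>x. x \<in> cball z r0 \<Longrightarrow> infdist x E \<le> C * infdist (\<Phi> x) L"
    using submanifold_flattening[OF E \<open>z \<in> E\<close>] by metis
  obtain r1 where r1: "0 < r1" "cball z r1 \<subseteq> \<Omega>"
    using assms(1,2,4) open_contains_cball by blast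
  define r where "r = min r0 r1"
  have r: "0 < r" "cball z r \<subseteq> \<Omega>" "cball z r \<subseteq> U" "cball z r \<subseteq> cball z r0"
    using r1 U(2,4) by (auto simp: r_def)
  define g where "g x = infdist (\<Phi> x) L" for x
  have contg: "continuous_on (cball z r) g"
    unfolding g_def by (intro continuous_on_infdist continuous_on_subset[OF C_on_continuous[OF U(5)] r(3)])
  obtain G where G: "0 < G" "\<And>x. x \<in> cball z r \<Longrightarrow> g x \<le> G"
  proof -
    have "bounded (g ` cball z r)"
      using compact_imp_bounded[OF compact_continuous_image[OF contg compact_cball]] .
    then obtain B where B: "0 < B" "\<And>x. x \<in> cball z r \<Longrightarrow> norm (g x) \<le> B"
      unfolding bounded_pos by blast
    show ?thesis
    proof (rule that[OF B(1)])
      show "g x \<le> B" if "x \<in> cball z r" for x using B(2)[OF that] by simp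
    qed
  qed
  have contQ: "continuous_on (cball z r) Q"
    using Q(1) unfolding smooth_on_def by (meson C_on_continuous continuous_on_subset subset_UNIV)
  have touch: "\<exists>x t e b. x \<in> ball z r - E \<and> dist x z < \<tau> \<and> 0 < t \<and> t < \<tau> \<and> norm e \<le> 1 \<and>
       \<bar>u x - Q x\<bar> < \<tau> \<and> (\<forall>y\<in>ball z r. Q y + t * (e \<bullet> \<Phi> y) + b \<le> u y) \<and>
       Q x + t * (e \<bullet> \<Phi> x) + b = u x" if "0 < \<tau>" for \<tau>
  proof -
    \<comment> \<open>the bounds after \<open>t < \<tau>\<close> ensure, in this order, that at the minimum point \<open>u\<close> is
    \<open>\<tau>\<close>-close to \<open>Q\<close>, that this point is interior, that it is \<open>\<tau>\<close>-close to \<open>z\<close>, and that the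
    lowerconical condition yields a negative value inside the ball\<close>
    have "\<exists>t. 0 < t \<and> t < \<tau> \<and> t < \<tau> / G \<and> t < c * r^2 / G \<and> t < c * \<tau>^2 / G \<and> t < C * c * r"
    proof -
      define M where "M = Min {\<tau>, \<tau> / G, c * r^2 / G, c * \<tau>^2 / G, C * c * r}"
      have "0 < M" using \<open>0 < \<tau>\<close> \<open>0 < c\<close> G(1) U(3) r(1) by (simp add: M_def)
      then obtain t where "0 < t" "t < M" using dense by blast
      then show ?thesis by (intro exI[of _ t]) (simp add: M_def)
    qed
    then obtain t where t: "0 < t" "t < \<tau>" "t * G < \<tau>" "t * G < c * r^2" "t * G < c * \<tau>^2" "t < C * c * r"
      using G(1) by (auto simp: pos_less_divide_eq)
    define \<epsilon> where "\<epsilon> = t / C"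
    have "0 < \<epsilon>" using t U by (simp add: \<epsilon>_def)
    have "(INF x\<in>\<Omega>. ereal ((u x + - Q x) - (u z + - Q z) - \<epsilon> * infdist x E)) < 0"
      using lc smooth_on_uminus[OF Q(1) assms(1)] \<open>z \<in> E\<close> \<open>0 < \<epsilon>\<close> unfolding lowerconical_on_def by blast
    then obtain x1 where x1: "x1 \<in> \<Omega>" "u x1 - Q x1 < \<epsilon> * infdist x1 E"
      using Q(2) by (auto simp: INF_less_iff)
    define n where "n = norm (x1 - z)"
    have "infdist x1 E \<le> n" using infdist_le[OF \<open>z \<in> E\<close>, of x1] by (simp add: n_def dist_norm)
    then have "\<epsilon> * infdist x1 E \<le> \<epsilon> * n" using \<open>0 < \<epsilon>\<close> by simp
    \<comment> \<open>the quadratic gap grows like \<open>n^2\<close> and the cone only like \<open>n\<close>\<close>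
    then have lt: "c * n^2 < \<epsilon> * n" using gap[OF x1(1)] x1(2) by (simp add: n_def)
    then have "n \<noteq> 0" by auto
    then have "0 < n" by (simp add: n_def)
    then have "c * n < \<epsilon>" using lt by (simp add: power2_eq_square)
    also have "\<epsilon> < c * r" using t(6) U(3) by (simp add: \<epsilon>_def pos_divide_less_eq mult_ac)
    finally have "n < r" using \<open>0 < c\<close> by simp
    then have x1r: "x1 \<in> cball z r" by (simp add: n_def dist_norm norm_minus_commute)
    have "\<epsilon> * infdist x1 E \<le> \<epsilon> * (C * g x1)"
      using cmp[of x1] x1r r(4) \<open>0 < \<epsilon>\<close> unfolding g_def by (intro mult_left_mono) auto
    then have neg1: "u x1 - (Q x1 + t * g x1) < 0"
      using x1(2) U(3) by (simp add: \<epsilon>_def)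
    define w where "w x = u x - (Q x + t * g x)" for x
    have "u \<in> LSC \<Omega>" using lc by (simp add: lowerconical_on_def)
    then have "w \<in> LSC (cball z r)"
      unfolding w_def using r(2) contQ contg by (intro LSC_diff_continuous[of u \<Omega>] continuous_intros)
    then obtain x where x: "x \<in> cball z r" "\<And>y. y \<in> cball z r \<Longrightarrow> w x \<le> w y"
      using LSC_attains_min[of "cball z r" w] r(1) by auto
    have neg: "u x - Q x < t * g x"
      using x(2)[OF x1r] neg1 by (simp add: w_def)
    have tG: "t * g x \<le> t * G" using G(2)[OF x(1)] t(1) by simp
    have gapx: "Q x + c * norm (x - z)^2 \<le> u x" using gap x(1) r(2) by blast
    have "c * norm (x - z)^2 < c * r^2" "c * norm (x - z)^2 < c * \<tau>^2"
      using gapx neg tG t by linarith+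
    then have "norm (x - z)^2 < r^2" "norm (x - z)^2 < \<tau>^2"
      using \<open>0 < c\<close> by simp_all
    then have d: "dist x z < r" "dist x z < \<tau>"
      using power2_less_imp_less r(1) \<open>0 < \<tau>\<close> unfolding dist_norm by (meson less_imp_le)+
    have pos: "0 \<le> u x - Q x"
      using gapx \<open>0 < c\<close> by (smt (verit) mult_nonneg_nonneg zero_le_power2)
    have "x \<notin> E"
    proof
      assume "x \<in> E"
      then have "g x = 0" using L x(1) r(3) unfolding g_def by auto
      then show False using neg pos by simp
    qed
    obtain e where e: "norm e \<le> 1" "e \<bullet> \<Phi> x = g x" "\<And>y. e \<bullet> y \<le> infdist y L"
      using subspace_norming_normal[OF L(1)] unfolding g_def by metis
    have "Q y + t * (e \<bullet> \<Phi> y) + w x \<le> u y" if "y \<in> ball z r" for y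
    proof -
      have "w x \<le> u y - (Q y + t * g y)" using x(2)[of y] that by (simp add: w_def)
      moreover have "t * (e \<bullet> \<Phi> y) \<le> t * g y" using e(3) t(1) by (simp add: g_def)
      ultimately show ?thesis by linarith
    qed
    moreover have "Q x + t * (e \<bullet> \<Phi> x) + w x = u x" using e(2) by (simp add: w_def)
    moreover have "\<bar>u x - Q x\<bar> < \<tau>" using pos neg tG t(3) by linarith
    moreover have "x \<in> ball z r - E" using d \<open>x \<notin> E\<close> by (simp add: dist_commute)
    ultimately show ?thesis using d(2) t(1,2) e(1) by blast
  qed
  have "ball z r \<subseteq> \<Omega>" "ball z r \<subseteq> U" using r ball_subset_cball by blast+
  then show ?thesis
    using that[OF r(1) _ _ touch] C_on_subset[OF U(5)] by blast
qed

section \<open>Passing to the limit\<close>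

lemma frechet_derivative_inner_const:
  assumes "\<Phi> differentiable (at x)"
  shows "frechet_derivative (\<lambda>y. e \<bullet> \<Phi> y) (at x) v = e \<bullet> frechet_derivative \<Phi> (at x) v"
proof -
  have "(\<Phi> has_derivative frechet_derivative \<Phi> (at x)) (at x)"
    using assms unfolding frechet_derivative_works .
  then have "((\<lambda>y. e \<bullet> \<Phi> y) has_derivative (\<lambda>v. e \<bullet> frechet_derivative \<Phi> (at x) v)) (at x)"
    by (rule has_derivative_inner_right)
  from frechet_derivative_at[OF this] show ?thesis by metis
qed

lemma vanishing_scaled_inner:
  assumes "t \<longlonglongrightarrow> (0::real)" and "\<And>m. norm (e m) \<le> 1" and "D \<longlonglongrightarrow> d"
  shows "(\<lambda>m. t m * (e m \<bullet> D m)) \<longlonglongrightarrow> 0"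
proof (rule Lim_null_comparison)
  have "\<bar>e m \<bullet> D m\<bar> \<le> norm (D m)" for m
    using Cauchy_Schwarz_ineq2[of "e m" "D m"] mult_right_mono[OF assms(2)[of m] norm_ge_zero[of "D m"]]
    by simp
  then show "\<forall>\<^sub>F m in sequentially. norm (t m * (e m \<bullet> D m)) \<le> \<bar>t m\<bar> * norm (D m)"
    by (intro always_eventually allI) (simp add: abs_mult mult_left_mono)
  have "(\<lambda>m. \<bar>t m\<bar> * norm (D m)) \<longlonglongrightarrow> \<bar>0\<bar> * norm d"
    by (intro tendsto_intros assms)
  then show "(\<lambda>m. \<bar>t m\<bar> * norm (D m)) \<longlonglongrightarrow> 0" by simp
qed

text \<open>\<open>C\<^sup>2\<close> bounds on \<open>y \<mapsto> e \<bullet> \<Phi> y\<close> hold uniformly for \<open>e\<close> in the unit ball, so the 2-jets vanish in the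
  limit although \<open>e m\<close> need not converge.\<close>

lemma vanishing_perturbation:
  fixes \<Phi> :: "real^'n \<Rightarrow> 'b::real_inner"
  assumes W: "open W" and \<Phi>: "C_on 2 W \<Phi>" and x: "\<And>m. x m \<in> W" "x \<longlonglongrightarrow> z" "z \<in> W"
    and t: "t \<longlonglongrightarrow> 0" and e: "\<And>m. norm (e m) \<le> 1"
  shows vanishing_grad: "(\<lambda>m. t m *\<^sub>R grad (\<lambda>y. e m \<bullet> \<Phi> y) (x m)) \<longlonglongrightarrow> 0"
    and vanishing_hessian: "(\<lambda>m. t m *\<^sub>R hessian (\<lambda>y. e m \<bullet> \<Phi> y) (x m)) \<longlonglongrightarrow> 0"
proof -
  define P where "P i y = frechet_derivative \<Phi> (at y) (axis i 1)" for i y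
  have diff: "\<Phi> differentiable (at y)" "P i differentiable (at y)" if "y \<in> W" for i y
    using \<Phi> that by (auto simp: numeral_2_eq_2 P_def[abs_def])
  have cont: "continuous_on W (\<lambda>y. frechet_derivative (P i) (at y) (axis j 1))" for i j
    using \<Phi> by (auto simp: numeral_2_eq_2 P_def[abs_def])
  have contP: "continuous_on W (P i)" for i
    using diff(2) by (meson continuous_at_imp_continuous_on differentiable_imp_continuous_within)
  have lim: "(\<lambda>m. h (x m)) \<longlonglongrightarrow> h z" if "continuous_on W h" for h :: "real^'n \<Rightarrow> 'b"
    by (rule continuous_on_tendsto_compose[OF that x(2,3)]) (simp add: x)
  have inner: "frechet_derivative (\<lambda>y. e m \<bullet> \<Phi> y) (at y) (axis i 1) = e m \<bullet> P i y" if "y \<in> W" for m i y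
    unfolding P_def by (rule frechet_derivative_inner_const[OF diff(1)[OF that]])
  have C2: "C_on 2 W (\<lambda>y. e m \<bullet> \<Phi> y)" for m
    by (rule C_on_bounded_linear_comp[OF W bounded_linear_inner_right \<Phi>])
  have hess: "hessian (\<lambda>y. e m \<bullet> \<Phi> y) (x m) $ i $ j
      = e m \<bullet> frechet_derivative (P i) (at (x m)) (axis j 1)" for m i j
  proof -
    have "((\<lambda>y. e m \<bullet> P i y) has_derivative (\<lambda>v. e m \<bullet> frechet_derivative (P i) (at (x m)) v)) (at (x m))"
      using diff(2)[OF x(1)] unfolding frechet_derivative_works by (rule has_derivative_inner_right)
    then have "((\<lambda>y. frechet_derivative (\<lambda>y. e m \<bullet> \<Phi> y) (at y) (axis i 1)) has_derivative
        (\<lambda>v. e m \<bullet> frechet_derivative (P i) (at (x m)) v)) (at (x m))"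
      by (rule has_derivative_transform_within_open[OF _ W x(1)]) (simp add: inner)
    from frechet_derivative_at[OF this] show ?thesis
      unfolding hessian_component[OF C2 x(1)] by metis
  qed
  show "(\<lambda>m. t m *\<^sub>R grad (\<lambda>y. e m \<bullet> \<Phi> y) (x m)) \<longlonglongrightarrow> 0"
    by (rule vec_tendstoI)
      (simp add: inner[OF x(1)] flip: frechet_derivative_axis,
        rule vanishing_scaled_inner[OF t e lim[OF contP]])
  show "(\<lambda>m. t m *\<^sub>R hessian (\<lambda>y. e m \<bullet> \<Phi> y) (x m)) \<longlonglongrightarrow> 0"
    by (rule vec_tendstoI, rule vec_tendstoI)
      (simp add: hess, rule vanishing_scaled_inner[OF t e lim[OF cont]])
qed

text \<open>The inequality at the touching points outside \<open>E\<close> passes to the limit: the 2-jets converge to that of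
  \<open>Q\<close> at \<open>z\<close>, \<open>F\<close> is continuous, and \<open>f\<close> is upper semicontinuous.\<close>

lemma viscosity_inequality_at_strict_minorant:
  fixes \<Omega> E :: "(real^'n) set" and u Q f :: "real^'n \<Rightarrow> real"
  assumes "open \<Omega>" and F: "continuous_on (\<Omega> \<times> UNIV \<times> UNIV \<times> sym_matrices) (\<lambda>(x, s, p, M). F x s p M)"
    and "E \<subseteq> \<Omega>" and E: "smooth_closed_submanifold k E" and "z \<in> E"
    and f: "f \<in> USC \<Omega>" and lc: "lowerconical_on \<Omega> E u" and visc: "viscosity_le F f (\<Omega> - E) u"
    and Q: "smooth_on UNIV Q" "Q z = u z" and "0 < c"
    and gap: "\<And>x. x \<in> \<Omega> \<Longrightarrow> Q x + c * norm (x - z)^2 \<le> u x"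
  shows "F z (u z) (grad Q z) (hessian Q z) \<le> f z"
proof -
  obtain \<Phi> :: "real^'n \<Rightarrow> real^'n" and r where r: "0 < r" "ball z r \<subseteq> \<Omega>" and \<Phi>: "C_on 2 (ball z r) \<Phi>"
    and touch: "\<And>\<tau>. 0 < \<tau> \<Longrightarrow> \<exists>x t e b. x \<in> ball z r - E \<and> dist x z < \<tau> \<and> 0 < t \<and> t < \<tau> \<and> norm e \<le> 1 \<and>
       \<bar>u x - Q x\<bar> < \<tau> \<and> (\<forall>y\<in>ball z r. Q y + t * (e \<bullet> \<Phi> y) + b \<le> u y) \<and>
       Q x + t * (e \<bullet> \<Phi> x) + b = u x"
    using touching_near_submanifold[OF assms(1,3,4,5) lc Q \<open>0 < c\<close> gap] by metis
  define \<tau> where "\<tau> m = inverse (real (Suc m))" for m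
  have \<tau>: "0 < \<tau> m" "\<tau> \<longlonglongrightarrow> 0" for m
    using LIMSEQ_inverse_real_of_nat by (auto simp: \<tau>_def[abs_def])
  obtain x t e b where
    x: "\<And>m. x m \<in> ball z r - E" and xz: "\<And>m. dist (x m) z < \<tau> m"
    and t: "\<And>m. 0 < t m" "\<And>m. t m < \<tau> m" and e: "\<And>m. norm (e m) \<le> 1"
    and ux: "\<And>m. \<bar>u (x m) - Q (x m)\<bar> < \<tau> m"
    and below: "\<And>m y. y \<in> ball z r \<Longrightarrow> Q y + t m * (e m \<bullet> \<Phi> y) + b m \<le> u y"
    and eq: "\<And>m. Q (x m) + t m * (e m \<bullet> \<Phi> (x m)) + b m = u (x m)"
    using touch[OF \<tau>(1)] by metis
  define W where "W = ball z r"
  have W: "open W" "z \<in> W" "\<And>m. x m \<in> W" using x r(1) by (auto simp: W_def)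
  have xlim: "x \<longlonglongrightarrow> z"
    unfolding tendsto_dist_iff[of x]
    by (rule tendsto_sandwich[OF _ _ tendsto_const \<tau>(2)]) (use xz in \<open>auto intro: always_eventually less_imp_le\<close>)
  have tlim: "t \<longlonglongrightarrow> 0"
    by (rule tendsto_sandwich[OF _ _ tendsto_const \<tau>(2)]) (use t in \<open>auto intro: always_eventually less_imp_le\<close>)
  have C2Q: "C_on 2 UNIV Q" using Q(1) by (simp add: smooth_on_def)
  then have C2Q': "C_on 2 W Q" by (rule C_on_subset) simp
  have C2e: "C_on 2 W (\<lambda>y. e m \<bullet> \<Phi> y)" for m
    using C_on_bounded_linear_comp[OF W(1) bounded_linear_inner_right] \<Phi> by (simp add: W_def)
  define \<psi> where "\<psi> m y = Q y + t m * (e m \<bullet> \<Phi> y) + b m" for m y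
  have le: "F (x m) (u (x m)) (grad (\<psi> m) (x m)) (hessian (\<psi> m) (x m)) \<le> f (x m)" for m
  proof -
    have "\<forall>\<^sub>F y in nhds (x m). y \<in> W" using W by (simp add: eventually_nhds_in_open)
    then have "\<forall>\<^sub>F y in nhds (x m). \<psi> m y \<le> u y"
      by eventually_elim (simp add: \<psi>_def below W_def)
    moreover have "C_on 2 W (\<psi> m)"
      unfolding \<psi>_def by (rule C_on_add_scaled[OF W(1,2) C2Q' C2e])
    moreover have "\<psi> m (x m) = u (x m)" using eq by (simp add: \<psi>_def)
    moreover have "x m \<in> \<Omega> - E" using x r(2) by blast
    ultimately show ?thesis
      using visc W(1,3) unfolding viscosity_le_def by metis
  qed
  have sym: "hessian (\<psi> m) (x m) \<in> sym_matrices" for m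
    unfolding \<psi>_def by (rule hessian_symmetric[OF W(1) C_on_add_scaled[OF W(1,2) C2Q' C2e] W(3)])
  have grad: "(\<lambda>m. grad (\<psi> m) (x m)) \<longlonglongrightarrow> grad Q z"
  proof -
    have "(\<lambda>m. grad Q (x m)) \<longlonglongrightarrow> grad Q z"
      by (rule continuous_on_tendsto_compose[OF C2_continuous_grad[OF C2Q] xlim]) auto
    from tendsto_add[OF this vanishing_grad[OF W(1) \<Phi>[folded W_def] W(3) xlim W(2) tlim e]]
    show ?thesis
      unfolding \<psi>_def by (simp add: grad_add_scaled[OF W(1) W(3) C2Q' C2e])
  qed
  have hess: "(\<lambda>m. hessian (\<psi> m) (x m)) \<longlonglongrightarrow> hessian Q z"
  proof -
    have "(\<lambda>m. hessian Q (x m)) \<longlonglongrightarrow> hessian Q z"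
      by (rule continuous_on_tendsto_compose[OF C2_continuous_hessian[OF C2Q] xlim]) auto
    from tendsto_add[OF this vanishing_hessian[OF W(1) \<Phi>[folded W_def] W(3) xlim W(2) tlim e]]
    show ?thesis
      unfolding \<psi>_def by (simp add: hessian_add_scaled[OF W(1) W(3) C2Q' C2e])
  qed
  have ulim: "(\<lambda>m. u (x m)) \<longlonglongrightarrow> u z"
  proof -
    have "(\<lambda>m. Q (x m)) \<longlonglongrightarrow> Q z"
      by (rule continuous_on_tendsto_compose[OF C_on_continuous[OF C2Q] xlim]) auto
    moreover have "(\<lambda>m. u (x m) - Q (x m)) \<longlonglongrightarrow> 0"
      by (rule Lim_null_comparison[OF always_eventually \<tau>(2)]) (use ux in \<open>auto intro: less_imp_le\<close>)
    ultimately show ?thesis using tendsto_add Q(2) by fastforce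
  qed
  have "(\<lambda>m. (x m, u (x m), grad (\<psi> m) (x m), hessian (\<psi> m) (x m)))
      \<longlonglongrightarrow> (z, u z, grad Q z, hessian Q z)"
    by (intro tendsto_Pair xlim ulim grad hess)
  moreover have x\<Omega>: "x m \<in> \<Omega>" for m using x r(2) by blast
  moreover have "z \<in> \<Omega>" using assms(3,5) by blast
  ultimately have "(\<lambda>m. F (x m) (u (x m)) (grad (\<psi> m) (x m)) (hessian (\<psi> m) (x m)))
      \<longlonglongrightarrow> F z (u z) (grad Q z) (hessian Q z)"
    using continuous_on_tendsto_compose[OF F, of _ "(z, u z, grad Q z, hessian Q z)" sequentially]
      sym hessian_symmetric[OF open_UNIV C2Q] by fastforce
  moreover have "x m \<in> \<Omega> - {z}" for m using x[of m] x\<Omega> \<open>z \<in> E\<close> by auto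
  ultimately show ?thesis
    using USC_limit_le[OF f _ _ xlim _ le] assms(3,5) by blast
qed

theorem theorem1p3:
  fixes \<Omega> E :: "(real^'n) set"
    and F :: "real^'n \<Rightarrow> real \<Rightarrow> real^'n \<Rightarrow> real^'n^'n \<Rightarrow> real"
    and f u :: "real^'n \<Rightarrow> real"
    and k :: nat
  assumes "bounded \<Omega>" and "connected \<Omega>" and "open \<Omega>"
    and "continuous_on (\<Omega> \<times> UNIV \<times> UNIV \<times> sym_matrices) (\<lambda>(x, s, p, M). F x s p M)"
    and "\<And>x s p M N. x \<in> \<Omega> \<Longrightarrow> M \<in> sym_matrices \<Longrightarrow> N \<in> posdef_matrices \<Longrightarrow>
           F x s p (M + N) \<ge> F x s p M"
    and "k \<le> CARD('n) - 1"
    and "E \<subseteq> \<Omega>" and "smooth_closed_submanifold k E"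
    and "f \<in> USC \<Omega>"
    and "u \<in> LSC \<Omega>" and "lowerconical_on \<Omega> E u"
    and "viscosity_le F f (\<Omega> - E) u"
  shows "viscosity_le F f \<Omega> u"
  unfolding viscosity_le_def
proof (intro ballI allI impI, elim conjE exE)
  fix z \<phi> W
  assume z: "z \<in> \<Omega>" and W: "open W" "z \<in> W" "C_on 2 W \<phi>"
    and below: "\<forall>\<^sub>F x in nhds z. \<phi> x \<le> u x" and eq: "\<phi> z = u z"
  show "F z (\<phi> z) (grad \<phi> z) (hessian \<phi> z) \<le> f z"
  proof (cases "z \<in> E")
    case False
    then show ?thesis
      using assms(12) z W below eq unfolding viscosity_le_def by blast
  next
    case True
    note sym = hessian_symmetric[OF W(1,3,2)]
    define H where "H \<delta> = hessian \<phi> z - mat \<delta>" for \<delta>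
    have H: "H \<delta> \<in> sym_matrices" for \<delta>
      using sym mat_sym[of \<delta>] by (simp add: H_def sym_matrices_def transpose_def vec_eq_iff)
    obtain m where m: "\<And>x. x \<in> \<Omega> \<Longrightarrow> m \<le> u x"
    proof -
      obtain m where "ereal m < (INF x\<in>\<Omega>. ereal (u x))"
        using assms(11) ereal_dense2[of "-\<infinity>"] unfolding lowerconical_on_def by blast
      then have "m \<le> u x" if "x \<in> \<Omega>" for x
        using less_INF_D[OF _ that] by (metis ereal_less_eq(3) less_imp_le)
      then show ?thesis using that by blast
    qed
    have approx: "F z (u z) (grad \<phi> z) (H \<delta>) \<le> f z" if \<delta>: "0 < \<delta>" for \<delta>
    proof -
      obtain K where K: "\<And>x. x \<in> \<Omega> \<Longrightarrow>
          quartic (u z) (grad \<phi> z) (H \<delta>) K z x + \<delta> / 4 * norm (x - z)^2 \<le> u x"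
        using strict_quartic_minorant[OF W(1,3,2) assms(1) m below eq \<delta>] unfolding H_def by blast
      have "F z (u z) (grad (quartic (u z) (grad \<phi> z) (H \<delta>) K z) z)
          (hessian (quartic (u z) (grad \<phi> z) (H \<delta>) K z) z) \<le> f z"
        by (rule viscosity_inequality_at_strict_minorant[OF assms(3,4,7,8) True assms(9,11,12) _ _ _ K])
          (use \<delta> in \<open>simp_all add: smooth_on_quartic quartic_center\<close>)
      then show ?thesis
        by (simp add: grad_quartic[OF H] hessian_quartic[OF H])
    qed
    \<comment> \<open>only now let \<open>\<delta>\<close> tend to \<open>0\<close>, since the minorant depends on it without any uniformity\<close>
    define \<delta> where "\<delta> m = inverse (real (Suc m))" for m
    have "(\<lambda>m. H (\<delta> m)) \<longlonglongrightarrow> H 0"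
    proof -
      have "(\<lambda>m. mat (\<delta> m) :: real^'n^'n) \<longlonglongrightarrow> mat 0"
      proof (rule vec_tendstoI, rule vec_tendstoI)
        show "(\<lambda>m. (mat (\<delta> m) :: real^'n^'n) $ i $ j) \<longlonglongrightarrow> mat 0 $ i $ j" for i j
          using LIMSEQ_inverse_real_of_nat by (cases "i = j") (simp_all add: mat_def \<delta>_def)
      qed
      then show ?thesis unfolding H_def by (intro tendsto_diff tendsto_const)
    qed
    then have "(\<lambda>m. (z, u z, grad \<phi> z, H (\<delta> m))) \<longlonglongrightarrow> (z, u z, grad \<phi> z, H 0)"
      by (intro tendsto_Pair tendsto_const)
    from continuous_on_tendsto_compose[OF assms(4) this]
    have "(\<lambda>m. F z (u z) (grad \<phi> z) (H (\<delta> m))) \<longlonglongrightarrow> F z (u z) (grad \<phi> z) (H 0)"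
      using z H by auto
    then have "F z (u z) (grad \<phi> z) (H 0) \<le> f z"
      by (rule tendsto_upperbound) (auto intro!: always_eventually approx simp: \<delta>_def)
    moreover have "H 0 = hessian \<phi> z"
      by (simp add: H_def mat_def vec_eq_iff)
    ultimately show ?thesis by (simp add: eq)
  qed
qed

end
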